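(* The competitive ratio of the Greedy policy is unbounded: there is no finite $\rho$ such that $J^{\mathrm{Greedy}}\le\rho\,J^{OPT}$ holds for every matching-cost function $f$ that is positive, finite and componentwise non-increasing on $\mathcal F$ and every finite balanced complete-tuple arrival sequence.
   Context: **Model.** There are $N\ge2$ agent types with waiting-cost rates $c_1,\dots,c_N>0$. Agents of each type arrive over continuous time $t\ge0$ (arbitrary arrival times, finitely many in any finite interval). The state $\mathbf{X}(t)\in\mathbb{Z}_+^N$ records the number of unmatched agents of each type; the system starts empty. A type-$i$ arrival changes the state by $\mathbf{X}\leftarrow\mathbf{X}+\mathbf{e}_i$. A match (of one complete tuple, one agent of each type) is feasible iff $\mathbf{X}\in\mathcal F=\{\mathbf{x}\in\mathbb{Z}_+^N:\min_i x_i\ge1\}$, and changes the state by $\mathbf{X}\leftarrow\mathbf{X}-\mathbf{1}$. A policy may execute matches at any calendar times (several matches at one time are allowed). Events are processed one at a time; simultaneous arrivals are processed in an arbitrary but fixed order and a policy may re-evaluate its decision after each individual arrival. **Costs.** The waiting-cost rate in state $\mathbf{x}$ is $w(\mathbf{x})=\sum_i c_ix_i$. The $k$-th match of policy $\pi$, executed at time $\tau_k^\pi$, costs $f(\mathbf{Y}_k^\pi)$, where $\mathbf{Y}_k^\pi$ is the pre-match state. The matching-cost function $f:\mathbb{Z}_+^N\to\mathbb{R}_+$ satisfies $0<f(\mathbf{x})<\infty$ on $\mathcal F$ and $f(\mathbf{x})\le f(\mathbf{y})$ whenever $\mathbf{x},\mathbf{y}\in\mathcal F$, $\mathbf{x}\succeq\mathbf{y}$.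 **Finite balanced instance.** The finite arrival sequence contains exactly $K$ arrivals of each type, for some integer $K$. A policy that fails to execute all $K$ matches has cost $+\infty$; otherwise $J^\pi=\int_0^{\tau_K^\pi}w(\mathbf{X}^\pi(t))\,dt+\sum_{k=1}^K f(\mathbf{Y}_k^\pi)$. $J^{OPT}$ is the minimum total cost over offline policies knowing the whole arrival sequence in advance. The competitive ratio of a policy $\pi$ is the infimum of all $\rho$ such that $J^\pi\le\rho J^{OPT}$ on every instance. **Greedy policy.** Match one complete tuple immediately whenever feasible, i.e. whenever $\min_iX_i\ge1$. *)

theory Defs
  imports "HOL-Analysis.Analysis"
begin

text \<open>The agent types are the elements of a finite type \<open>'n\<close>, so the number of types is \<open>CARD('n)\<close>.\<close>

type_synonym 'n state = "'n \<Rightarrow> nat"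

text \<open>
  Arrivals are listed in the order in which they are processed; the list order also fixes the
  processing order of simultaneous arrivals.
\<close>

type_synonym 'n arrivals = "(real \<times> 'n) list"

datatype 'n event = Arrival 'n | Match

text \<open>
  A history lists all events, arrivals and matches, in processing order and with their calendar
  times.  A match may be placed between any two simultaneous arrivals, and several matches may
  carry the same time.
\<close>

type_synonym 'n history = "(real \<times> 'n event) list"

text \<open>
  A policy assigns a history to each matching-cost function and arrival sequence.  It sees the
  whole arrival sequence, i.e. offline policies are included.
\<close>

type_synonym 'n policy = "('n state \<Rightarrow> real) \<Rightarrow> 'n arrivals \<Rightarrow> 'n history"

definition feasible_states :: "'n::finite state set" where
  "feasible_states = {x. 1 \<le> Min (range x)}"

definition matching_cost_function :: "('n::finite state \<Rightarrow> real) \<Rightarrow> bool" where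
  "matching_cost_function f \<longleftrightarrow>
     (\<forall>x. 0 \<le> f x) \<and>
     (\<forall>x\<in>feasible_states. 0 < f x) \<and>
     (\<forall>x\<in>feasible_states. \<forall>y\<in>feasible_states. y \<le> x \<longrightarrow> f x \<le> f y)"

definition balanced_instance :: "'n arrivals \<Rightarrow> nat \<Rightarrow> bool" where
  "balanced_instance arr K \<longleftrightarrow>
     sorted (map fst arr) \<and> (\<forall>a\<in>set arr. 0 \<le> fst a) \<and>
     (\<forall>i. length (filter (\<lambda>a. snd a = i) arr) = K)"

fun apply_event :: "'n event \<Rightarrow> 'n state \<Rightarrow> 'n state" where
  "apply_event (Arrival i) x = x(i := x i + 1)"
| "apply_event Match x = (\<lambda>i. x i - 1)"

definition state_after :: "'n history \<Rightarrow> 'n state" where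
  "state_after h = fold (\<lambda>e. apply_event (snd e)) h (\<lambda>_. 0)"

definition state_at :: "'n history \<Rightarrow> real \<Rightarrow> 'n state" where
  "state_at h t = state_after (filter (\<lambda>e. fst e \<le> t) h)"

fun arrivals_of :: "'n history \<Rightarrow> 'n arrivals" where
  "arrivals_of [] = []"
| "arrivals_of ((t, Arrival i) # h) = (t, i) # arrivals_of h"
| "arrivals_of ((t, Match) # h) = arrivals_of h"

definition admissible :: "'n::finite arrivals \<Rightarrow> 'n history \<Rightarrow> bool" where
  "admissible arr h \<longleftrightarrow>
     arrivals_of h = arr \<and> sorted (map fst h) \<and> (\<forall>e\<in>set h. 0 \<le> fst e) \<and>
     (\<forall>k<length h. snd (h ! k) = Match \<longrightarrow> state_after (take k h) \<in> feasible_states)"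

definition offline_policy :: "'n::finite policy \<Rightarrow> bool" where
  "offline_policy \<pi> \<longleftrightarrow>
     (\<forall>f arr K. matching_cost_function f \<longrightarrow> balanced_instance arr K \<longrightarrow> admissible arr (\<pi> f arr))"

definition match_positions :: "'n history \<Rightarrow> nat list" where
  "match_positions h = filter (\<lambda>k. snd (h ! k) = Match) [0..<length h]"

text \<open>Matches are numbered from 1; by convention \<open>match_time h 0 = 0\<close>, for instances with no arrivals.\<close>

definition match_time :: "'n history \<Rightarrow> nat \<Rightarrow> real" where
  "match_time h k = (if k = 0 then 0 else fst (h ! (match_positions h ! (k - 1))))"

definition pre_match_state :: "'n history \<Rightarrow> nat \<Rightarrow> 'n state" where
  "pre_match_state h k = state_after (take (match_positions h ! (k - 1)) h)"

definition waiting_rate :: "('n::finite \<Rightarrow> real) \<Rightarrow> 'n state \<Rightarrow> real" where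
  "waiting_rate c x = (\<Sum>i\<in>UNIV. c i * real (x i))"

definition total_cost ::
    "('n::finite \<Rightarrow> real) \<Rightarrow> ('n state \<Rightarrow> real) \<Rightarrow> nat \<Rightarrow> 'n history \<Rightarrow> ereal" where
  "total_cost c f K h =
     (if length (match_positions h) = K
      then ereal (integral {0..match_time h K} (\<lambda>t. waiting_rate c (state_at h t))
                  + (\<Sum>k=1..K. f (pre_match_state h k)))
      else \<infinity>)"

text \<open>
  For every instance the infimum is attained: only finitely many interleavings of arrivals and
  matches are possible, and each is cheapest when its matches are executed as early as possible.
\<close>

definition opt_cost ::
    "('n::finite \<Rightarrow> real) \<Rightarrow> ('n state \<Rightarrow> real) \<Rightarrow> 'n arrivals \<Rightarrow> nat \<Rightarrow> ereal" where
  "opt_cost c f arr K = (INF \<pi>\<in>{\<pi>. offline_policy \<pi>}. total_cost c f K (\<pi> f arr))"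

definition competitive_ratio :: "('n::finite \<Rightarrow> real) \<Rightarrow> 'n policy \<Rightarrow> ereal" where
  "competitive_ratio c \<pi> = Inf {ereal \<rho> | \<rho>.
     \<forall>f arr K. matching_cost_function f \<longrightarrow> balanced_instance arr K \<longrightarrow>
       total_cost c f K (\<pi> f arr) \<le> ereal \<rho> * opt_cost c f arr K}"

text \<open>
  In state \<open>y\<close>, matching as long as feasible executes exactly \<open>Min (range y)\<close> matches.
\<close>

fun greedy_from :: "'n::finite state \<Rightarrow> 'n arrivals \<Rightarrow> 'n history" where
  "greedy_from x [] = []"
| "greedy_from x ((t, i) # arr) =
     (let y = x(i := x i + 1); m = Min (range y)
      in (t, Arrival i) # replicate m (t, Match) @ greedy_from (\<lambda>j. y j - m) arr)"

definition greedy :: "'n::finite policy" where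
  "greedy f arr = greedy_from (\<lambda>_. 0) arr"

text \<open>
  Sanity checks: the waiting-cost rate is integrable along every history, and the greedy policy
  is an admissible policy that matches exactly in the feasible states, without delay, and
  executes all matches of a balanced instance.
\<close>

lemma integrable_filter_le:
  fixes g :: "(real \<times> 'e) list \<Rightarrow> real"
  shows "(\<lambda>t. g (filter (\<lambda>e. fst e \<le> t) h)) integrable_on {a..b}"
proof (induction h arbitrary: g a b)
  case Nil
  then show ?case by (simp add: integrable_const_ivl)
next
  case (Cons e h)
  let ?F = "\<lambda>t. g (filter (\<lambda>e. fst e \<le> t) (e # h))"
  let ?l = "\<lambda>t. g (filter (\<lambda>e. fst e \<le> t) h)"
  let ?r = "\<lambda>t. (\<lambda>xs. g (e # xs)) (filter (\<lambda>e. fst e \<le> t) h)"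
  let ?m = "max a (min b (fst e))"
  have l: "?F integrable_on {a..?m}" if "a \<le> b"
  proof (rule integrable_spike[where S = "{?m}"])
    show "?l integrable_on {a..?m}" by (rule Cons.IH)
  qed (use that in auto)
  have r: "?F integrable_on {?m..b}" if "a \<le> b"
  proof (rule integrable_spike[where S = "{?m}"])
    show "?r integrable_on {?m..b}" by (rule Cons.IH)
  qed (use that in auto)
  show ?case
  proof (cases "a \<le> b")
    case True
    then show ?thesis
      by (intro Henstock_Kurzweil_Integration.integrable_combine[OF _ _ l r]) auto
  qed auto
qed

lemma waiting_rate_integrable:
  "(\<lambda>t. waiting_rate c (state_at h t)) integrable_on {a..b}"
  unfolding state_at_def
  using integrable_filter_le[of "\<lambda>xs. waiting_rate c (state_after xs)"] .

lemma feasible_iff: "x \<in> feasible_states \<longleftrightarrow> (\<forall>i. 1 \<le> x i)"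
  by (auto simp: feasible_states_def)

lemma arrivals_of_replicate [simp]:
  "arrivals_of (replicate m (t, Match) @ h) = arrivals_of h"
  by (induction m) auto

lemma arrivals_of_greedy_from: "arrivals_of (greedy_from x arr) = arr"
  by (induction x arr rule: greedy_from.induct) (auto simp: Let_def)

lemma times_greedy_from: "fst ` set (greedy_from x arr) \<subseteq> fst ` set arr"
proof (induction x arr rule: greedy_from.induct)
  case (2 x t i arr)
  define y where "y = x(i := x i + 1)"
  define m where "m = Min (range y)"
  have "fst ` set (greedy_from (\<lambda>j. y j - m) arr) \<subseteq> fst ` set arr"
    using "2.IH"[OF y_def m_def] .
  moreover have "greedy_from x ((t, i) # arr) =
      (t, Arrival i) # replicate m (t, Match) @ greedy_from (\<lambda>j. y j - m) arr"
    by (simp add: Let_def y_def m_def)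
  ultimately show ?case by (auto simp del: greedy_from.simps)
qed simp

lemma sorted_greedy_from:
  "sorted (map fst arr) \<Longrightarrow> sorted (map fst (greedy_from x arr))"
proof (induction x arr rule: greedy_from.induct)
  case (2 x t i arr)
  define y where "y = x(i := x i + 1)"
  define m where "m = Min (range y)"
  let ?g = "greedy_from (\<lambda>j. y j - m) arr"
  have *: "t \<le> fst e" if "e \<in> set ?g" for e
    using that times_greedy_from[of "\<lambda>j. y j - m" arr] "2.prems" by fastforce
  have "sorted (map fst ?g)"
    using 2 by (auto simp: y_def m_def)
  moreover have "greedy_from x ((t, i) # arr) = (t, Arrival i) # replicate m (t, Match) @ ?g"
    by (simp add: Let_def y_def m_def)
  ultimately show ?case
    using * by (auto simp: sorted_append map_replicate)
qed simp

lemma fold_replicate_Match: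
  "fold (\<lambda>e. apply_event (snd e)) (replicate m (t, Match)) y = (\<lambda>j. y j - m)"
  by (induction m arbitrary: y) (auto simp: fun_eq_iff)

lemma greedy_from_match_iff:
  assumes "x \<notin> feasible_states" "k \<le> length (greedy_from x arr)"
  shows "fold (\<lambda>e. apply_event (snd e)) (take k (greedy_from x arr)) x \<in> feasible_states \<longleftrightarrow>
    k < length (greedy_from x arr) \<and> snd (greedy_from x arr ! k) = Match"
    and "k < length (greedy_from x arr) \<Longrightarrow> snd (greedy_from x arr ! k) = Match \<Longrightarrow>
      0 < k \<and> fst (greedy_from x arr ! k) = fst (greedy_from x arr ! (k - 1))"
  using assms
proof (induction x arr arbitrary: k rule: greedy_from.induct)
  case (1 x)
  { case 1 then show ?case by simp }
  { case 2 then show ?case by simp }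
next
  case (2 x t i arr)
  define y where "y = x(i := x i + 1)"
  define m where "m = Min (range y)"
  define z where "z = (\<lambda>j. y j - m)"
  let ?g = "greedy_from z arr"
  let ?h = "greedy_from x ((t, i) # arr)"
  have h: "?h = (t, Arrival i) # replicate m (t, Match) @ ?g"
    by (simp add: Let_def y_def m_def z_def)
  note greedy_from.simps [simp del]
  have "m \<in> range y" unfolding m_def by (intro Min_in) auto
  then obtain j0 where j0: "y j0 = m" by auto
  have le: "m \<le> y j" for j unfolding m_def by simp
  have y: "x(i := Suc (x i)) = y" by (simp add: y_def)
  have z: "z \<notin> feasible_states"
    using j0 by (auto simp: feasible_iff z_def intro!: exI[of _ j0])
  have IH1: "fold (\<lambda>e. apply_event (snd e)) (take k ?g) z \<in> feasible_states \<longleftrightarrow>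
      k < length ?g \<and> snd (?g ! k) = Match" if "k \<le> length ?g" for k
    using "2.IH"(1)[OF y_def m_def, folded z_def, OF z that] .
  have IH2: "0 < k \<and> fst (?g ! k) = fst (?g ! (k - 1))"
    if "k < length ?g" "snd (?g ! k) = Match" for k
    using "2.IH"(2)[OF y_def m_def, folded z_def, OF that z] that by simp
  have cs: "k = 0 \<or> (\<exists>j<m. k = Suc j) \<or> (\<exists>j. k = Suc (m + j))" for k
    by presburger
  { case (1 k)
    consider "k = 0" | j where "k = Suc j" "j < m" | j where "k = Suc (m + j)"
      using cs[of k] by blast
    then show ?case
    proof cases
      case 1
      then show ?thesis using \<open>x \<notin> feasible_states\<close> by (simp add: h)
    next
      case (2 j)
      then have "take k ?h = (t, Arrival i) # replicate j (t, Match)"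
        by (simp add: h)
      moreover have "(\<lambda>l. y l - j) \<in> feasible_states"
        unfolding feasible_iff
      proof
        fix l show "1 \<le> y l - j" using 2 le[of l] by linarith
      qed
      moreover have "snd (?h ! k) = Match" "k < length ?h"
        using 2 by (simp_all add: h nth_append)
      ultimately show ?thesis
        by (simp add: fold_replicate_Match y del: fun_upd_apply fold_replicate)
    next
      case (3 j)
      then have "take k ?h = (t, Arrival i) # replicate m (t, Match) @ take j ?g"
        by (simp add: h)
      moreover have "?h ! k = ?g ! j" "k < length ?h \<longleftrightarrow> j < length ?g" "j \<le> length ?g"
        using 3 1 by (simp_all add: h nth_append)
      ultimately show ?thesis
        using IH1[of j]
        by (simp add: fold_replicate_Match y z_def[symmetric]
            del: fun_upd_apply fold_replicate)
    qed }
  { case (2 k)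
    consider "k = 0" | j where "k = Suc j" "j < m" | j where "k = Suc (m + j)"
      using cs[of k] by blast
    then show ?case
    proof cases
      case 1
      then show ?thesis using 2 by (simp add: h)
    next
      case (2 j)
      then show ?thesis by (cases j) (simp_all add: h nth_append)
    next
      case (3 j)
      then have "?h ! k = ?g ! j" "j < length ?g"
        using 2 by (simp_all add: h nth_append)
      then have "0 < j \<and> fst (?g ! j) = fst (?g ! (j - 1))"
        using 2 IH2[of j] by simp
      moreover have "?h ! (k - 1) = ?g ! (j - 1)" if "0 < j"
        using 3 that by (cases j) (simp_all add: h nth_append)
      ultimately show ?thesis
        using \<open>?h ! k = ?g ! j\<close> 3 by simp
    qed }
qed

lemma empty_infeasible: "(\<lambda>_. 0) \<notin> feasible_states"
  by (simp add: feasible_iff)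

lemma offline_policy_greedy: "offline_policy greedy"
  unfolding offline_policy_def
proof (intro allI impI)
  fix f :: "'a state \<Rightarrow> real" and arr :: "'a arrivals" and K
  assume arr: "balanced_instance arr K"
  have "0 \<le> fst e" if "e \<in> set (greedy f arr)" for e
  proof -
    have "fst e \<in> fst ` set arr"
      using that times_greedy_from unfolding greedy_def by blast
    then show ?thesis using arr by (auto simp: balanced_instance_def)
  qed
  moreover have "sorted (map fst (greedy f arr))"
    using arr by (simp add: greedy_def balanced_instance_def sorted_greedy_from)
  ultimately show "admissible arr (greedy f arr)"
    using greedy_from_match_iff(1)[OF empty_infeasible, of _ arr]
    by (simp add: admissible_def greedy_def arrivals_of_greedy_from state_after_def)
qed

lemma greedy_matches_iff_feasible:
  assumes "k \<le> length (greedy f arr)"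
  shows "state_after (take k (greedy f arr)) \<in> feasible_states \<longleftrightarrow>
    k < length (greedy f arr) \<and> snd (greedy f arr ! k) = Match"
  using greedy_from_match_iff(1)[OF empty_infeasible] assms
  by (simp add: greedy_def state_after_def)

lemma greedy_matches_immediately:
  assumes "k < length (greedy f arr)" "snd (greedy f arr ! k) = Match"
  shows "0 < k \<and> fst (greedy f arr ! k) = fst (greedy f arr ! (k - 1))"
  using greedy_from_match_iff(2)[OF empty_infeasible, of k arr] assms
  by (simp add: greedy_def)

lemma length_match_positions:
  "length (match_positions h) = length (filter (\<lambda>e. snd e = Match) h)"
proof -
  have "filter (\<lambda>e. snd e = Match) (map ((!) h) [0..<length h]) = map ((!) h) (match_positions h)"
    by (simp add: filter_map match_positions_def o_def)
  then show ?thesis by (simp add: map_nth)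
qed

lemma arrivals_of_append: "arrivals_of (h @ h') = arrivals_of h @ arrivals_of h'"
  by (induction h rule: arrivals_of.induct) auto

lemma state_plus_matches:
  assumes "\<forall>k<length h. snd (h ! k) = Match \<longrightarrow> state_after (take k h) \<in> feasible_states"
  shows "state_after h i + length (match_positions h) =
    length (filter (\<lambda>a. snd a = i) (arrivals_of h))"
  using assms
proof (induction h rule: rev_induct)
  case Nil
  then show ?case by (simp add: state_after_def match_positions_def)
next
  case (snoc e h)
  have "\<forall>k<length h. snd (h ! k) = Match \<longrightarrow> state_after (take k h) \<in> feasible_states"
  proof (intro allI impI)
    fix k assume "k < length h" "snd (h ! k) = Match"
    then show "state_after (take k h) \<in> feasible_states"
      using spec[OF snoc.prems, of k] by (simp add: nth_append)
  qed
  note IH = snoc.IH[OF this]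
  have feas: "snd e = Match \<Longrightarrow> state_after h \<in> feasible_states"
    using spec[OF snoc.prems, of "length h"] by simp
  obtain t a where e: "e = (t, a)" by (cases e)
  have st: "state_after (h @ [(t, a)]) = apply_event a (state_after h)" for t a
    by (simp add: state_after_def)
  show ?case
  proof (cases a)
    case (Arrival j)
    then show ?thesis
      using IH by (cases "i = j") (simp_all add: st e length_match_positions arrivals_of_append)
  next
    case Match
    then have "1 \<le> state_after h i" using feas e by (simp add: feasible_iff)
    then show ?thesis
      using Match IH by (simp add: st e length_match_positions arrivals_of_append)
  qed
qed

lemma greedy_executes_all_matches:
  assumes "balanced_instance arr K"
  shows "length (match_positions (greedy f arr)) = K"
proof -
  let ?h = "greedy f arr"
  have "state_after ?h \<notin> feasible_states"
    using greedy_matches_iff_feasible[of "length ?h" f arr] by simp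
  then obtain i where i: "state_after ?h i = 0"
    by (auto simp: feasible_iff not_le)
  have "\<forall>k<length ?h. snd (?h ! k) = Match \<longrightarrow> state_after (take k ?h) \<in> feasible_states"
    using greedy_matches_iff_feasible[of _ f arr] by (meson less_imp_le)
  from state_plus_matches[OF this, of i] show ?thesis
    using assms i by (simp add: balanced_instance_def greedy_def arrivals_of_greedy_from)
qed

end

theory Submission
  imports Defs
begin

text \<open>
  Let a match cost 1 if some type is represented by exactly one agent and \<open>\<delta>\<close> otherwise.
  Greedy never reaches a state with two complete tuples, so it pays 1 for each of its \<open>K\<close>
  matches.  If all agents arrive at time 0, then waiting is free, and the policy that starts to
  match only after the last arrival passes through the states \<open>(K,\<dots>,K), \<dots>, (1,\<dots>,1)\<close>; it pays 1
  only for the last match.  With \<open>\<delta> = 1/K\<close> its cost is at most 2, so the ratio is at least \<open>K/2\<close>.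
\<close>

section \<open>General bounds on costs and on the offline optimum\<close>

lemma total_cost_ge_matching_cost:
  fixes c :: "'n::finite \<Rightarrow> real"
  assumes "\<And>i. 0 \<le> c i" and "length (match_positions h) = K"
  shows "ereal (\<Sum>k=1..K. f (pre_match_state h k)) \<le> total_cost c f K h"
proof -
  have "0 \<le> integral {0..match_time h K} (\<lambda>t. waiting_rate c (state_at h t))"
    by (rule integral_nonneg[OF waiting_rate_integrable])
      (simp add: waiting_rate_def sum_nonneg assms)
  then show ?thesis using assms by (simp add: total_cost_def)
qed

lemma total_cost_nonneg:
  fixes c :: "'n::finite \<Rightarrow> real"
  assumes "\<And>i. 0 \<le> c i" and "matching_cost_function f"
  shows "0 \<le> total_cost c f K h"
proof (cases "length (match_positions h) = K")
  case True
  have "0 \<le> (\<Sum>k=1..K. f (pre_match_state h k))"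
    using assms(2) by (simp add: matching_cost_function_def sum_nonneg)
  then have "0 \<le> ereal (\<Sum>k=1..K. f (pre_match_state h k))" by simp
  also have "\<dots> \<le> total_cost c f K h"
    using assms(1) True by (rule total_cost_ge_matching_cost)
  finally show ?thesis .
qed (simp add: total_cost_def)

lemma opt_cost_nonneg:
  fixes c :: "'n::finite \<Rightarrow> real"
  assumes "\<And>i. 0 \<le> c i" and "matching_cost_function f"
  shows "0 \<le> opt_cost c f arr K"
  unfolding opt_cost_def by (intro INF_greatest total_cost_nonneg assms)

lemma opt_cost_le:
  fixes arr :: "'n::finite arrivals"
  assumes "admissible arr h"
  shows "opt_cost c f arr K \<le> total_cost c f K h"
proof -
  \<comment> \<open>An offline policy has to be admissible on every balanced instance, so the single
    history \<open>h\<close> is completed to a policy by falling back on \<open>greedy\<close>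
    elsewhere.\<close>
  let ?\<pi> = "\<lambda>f arr'. if arr' = arr then h else greedy f arr'"
  have "offline_policy ?\<pi>"
    using assms offline_policy_greedy by (auto simp: offline_policy_def)
  then have "opt_cost c f arr K \<le> total_cost c f K (?\<pi> f arr)"
    unfolding opt_cost_def by (intro INF_lower) simp
  then show ?thesis by simp
qed

section \<open>The states in which Greedy matches and the cost it pays there\<close>

lemma match_positions_nth:
  assumes "1 \<le> k" "k \<le> length (match_positions h)"
  shows "match_positions h ! (k - 1) < length h"
    and "snd (h ! (match_positions h ! (k - 1))) = Match"
proof -
  have "match_positions h ! (k - 1) \<in> set (match_positions h)"
    using assms by (intro nth_mem) simp
  then show "match_positions h ! (k - 1) < length h"
    and "snd (h ! (match_positions h ! (k - 1))) = Match"
    by (auto simp: match_positions_def)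
qed

text \<open>Induction over positions, by the kind of the preceding event. Before an arrival Greedy's
  state is infeasible, so some type is absent; feasibility after the arrival leaves exactly one
  agent of it. After a match, the single agent given by the induction hypothesis is gone, so no
  second match can follow directly.\<close>

lemma greedy_pre_match_has_single:
  assumes "k < length (greedy f arr)" "snd (greedy f arr ! k) = Match"
  shows "\<exists>i. state_after (take k (greedy f arr)) i = 1"
  using assms
proof (induction k)
  case 0
  then show ?case using greedy_matches_immediately by blast
next
  case (Suc k)
  let ?h = "greedy f arr"
  let ?x = "state_after (take k ?h)"
  have feas: "state_after (take (Suc k) ?h) \<in> feasible_states"
    using greedy_matches_iff_feasible[of "Suc k" f arr] Suc.prems by simp
  have step: "state_after (take (Suc k) ?h) = apply_event (snd (?h ! k)) ?x"
    using Suc.prems by (simp add: state_after_def take_Suc_conv_app_nth)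
  show ?case
  proof (cases "snd (?h ! k)")
    case (Arrival j)
    then have "?x \<notin> feasible_states"
      using greedy_matches_iff_feasible[of k f arr] Suc.prems by simp
    then obtain i where "?x i = 0" by (auto simp: feasible_iff not_le)
    moreover have "1 \<le> state_after (take (Suc k) ?h) i"
      using feas by (simp add: feasible_iff)
    ultimately have "state_after (take (Suc k) ?h) i = 1"
      using step Arrival by (auto split: if_splits)
    then show ?thesis ..
  next
    case Match
    then obtain i where "?x i = 1" using Suc by auto
    then have "state_after (take (Suc k) ?h) i = 0" using step Match by simp
    then show ?thesis using feas by (auto simp: feasible_iff dest: spec[of _ i])
  qed
qed

definition single_cost :: "real \<Rightarrow> 'n state \<Rightarrow> real" where
  "single_cost \<delta> x = (if \<exists>i. x i = 1 then 1 else \<delta>)"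

text \<open>Among feasible states the expensive ones are closed downwards: \<open>x i = 1\<close>
  and \<open>1 \<le> y i \<le> x i\<close> force \<open>y i = 1\<close>. With
  \<open>\<delta> \<le> 1\<close> this is monotonicity.\<close>

lemma matching_cost_function_single_cost:
  assumes "0 < \<delta>" "\<delta> \<le> 1"
  shows "matching_cost_function (single_cost \<delta> :: 'n::finite state \<Rightarrow> real)"
proof -
  have "single_cost \<delta> x \<le> single_cost \<delta> y"
    if "x \<in> feasible_states" "y \<in> feasible_states" "y \<le> x" for x y :: "'n state"
  proof (cases "\<exists>i. x i = 1")
    case True
    then obtain i where "x i = 1" ..
    then have "y i = 1"
      using that by (metis feasible_iff le_funD le_antisym)
    then show ?thesis using assms by (auto simp: single_cost_def)
  qed (use assms in \<open>auto simp: single_cost_def\<close>)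
  then show ?thesis
    using assms by (auto simp: matching_cost_function_def single_cost_def)
qed

lemma greedy_total_cost_ge:
  fixes c :: "'n::finite \<Rightarrow> real"
  assumes "\<And>i. 0 \<le> c i" and "balanced_instance arr K"
  shows "ereal (real K) \<le> total_cost c (single_cost \<delta>) K (greedy f arr)"
proof -
  let ?h = "greedy f arr"
  have len: "length (match_positions ?h) = K"
    using assms(2) by (rule greedy_executes_all_matches)
  have "single_cost \<delta> (pre_match_state ?h k) = 1" if "k \<in> {1..K}" for k
  proof -
    have "1 \<le> k" "k \<le> length (match_positions ?h)" using that len by simp_all
    from greedy_pre_match_has_single[OF match_positions_nth[OF this]]
    show ?thesis by (simp add: single_cost_def pre_match_state_def)
  qed
  then have "(\<Sum>k=1..K. single_cost \<delta> (pre_match_state ?h k)) = real K" by simp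
  then show ?thesis
    using total_cost_ge_matching_cost[OF assms(1) len, of "single_cost \<delta>"] by simp
qed

section \<open>The offline history that postpones all matches behind the last arrival\<close>

definition match_last :: "'n arrivals \<Rightarrow> nat \<Rightarrow> 'n history" where
  "match_last arr K = map (\<lambda>(t, i). (t, Arrival i)) arr @ replicate K (0, Match)"

lemma arrivals_of_map_Arrival: "arrivals_of (map (\<lambda>(t, i). (t, Arrival i)) arr) = arr"
  by (induction arr) auto

lemma match_positions_match_last:
  "match_positions (match_last arr K) = [length arr..<length arr + K]"
proof -
  have "filter (\<lambda>k. snd (match_last arr K ! k) = Match) [0..<length arr] = []"
    by (auto simp: filter_empty_conv match_last_def nth_append split: prod.split)
  moreover have "filter (\<lambda>k. snd (match_last arr K ! k) = Match) [length arr..<length arr + K]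
      = [length arr..<length arr + K]"
    by (auto simp: filter_id_conv match_last_def nth_append)
  ultimately show ?thesis
    by (simp add: match_positions_def match_last_def upt_add_eq_append[of 0 "length arr" K])
qed

lemma state_after_match_last:
  fixes arr :: "'n::finite arrivals"
  assumes "balanced_instance arr K" and "j \<le> K"
  shows "state_after (take (length arr + j) (match_last arr K)) = (\<lambda>_. K - j)"
proof -
  let ?a = "map (\<lambda>(t, i). (t, Arrival i)) arr"
  have no: "snd (?a ! k) \<noteq> Match" if "k < length ?a" for k
    using that by (simp split: prod.split)
  then have "match_positions ?a = []"
    by (auto simp: match_positions_def filter_empty_conv)
  \<comment> \<open>Counting agents: without matches, the state equals the number of arrivals of
    each type.\<close>
  then have "state_after ?a i = K" for i
    using state_plus_matches[of ?a i] no assms(1)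
    by (simp add: arrivals_of_map_Arrival balanced_instance_def)
  then have "state_after ?a = (\<lambda>_. K)" by auto
  moreover have "take (length arr + j) (match_last arr K) = ?a @ replicate j (0, Match)"
    using assms(2) by (simp add: match_last_def)
  ultimately show ?thesis
    by (simp add: state_after_def fold_replicate_Match del: fold_replicate)
qed

lemma admissible_match_last:
  assumes "balanced_instance arr K" and "\<And>a. a \<in> set arr \<Longrightarrow> fst a = 0"
  shows "admissible arr (match_last arr K)"
proof -
  let ?h = "match_last arr K"
  have zero: "fst e = 0" if "e \<in> set ?h" for e
    using that assms(2) by (auto simp: match_last_def)
  then have "map fst ?h = replicate (length ?h) 0"
    by (intro replicate_eqI) auto
  then have "sorted (map fst ?h)" by simp
  moreover have "arrivals_of ?h = arr"
    using arrivals_of_replicate[of K 0 "[]"]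
    by (simp add: match_last_def arrivals_of_append arrivals_of_map_Arrival)
  moreover have "state_after (take k ?h) \<in> feasible_states"
    if "k < length ?h" "snd (?h ! k) = Match" for k
  proof -
    have "k \<in> set (match_positions ?h)"
      using that by (simp add: match_positions_def)
    then have "length arr \<le> k" "k < length arr + K"
      by (simp_all add: match_positions_match_last)
    then show ?thesis
      using state_after_match_last[OF assms(1), of "k - length arr"]
      by (auto simp: feasible_iff)
  qed
  ultimately show ?thesis
    using zero by (auto simp: admissible_def)
qed

text \<open>Every match is stamped 0, so the waiting integral runs over the degenerate interval
  \<open>{0..0}\<close>; for \<open>K = 0\<close> this is the convention in
  \<open>match_time\<close>.\<close>

lemma total_cost_match_last:
  assumes "balanced_instance arr K"
  shows "total_cost c f K (match_last arr K) = ereal (\<Sum>k=1..K. f (\<lambda>_. K - (k - 1)))"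
proof -
  let ?h = "match_last arr K"
  have "match_time ?h K = 0"
  proof (cases K)
    case (Suc k)
    then have "match_positions ?h ! (K - 1) = length arr + k"
      unfolding match_positions_match_last by (subst nth_upt) auto
    then show ?thesis
      by (simp add: match_time_def match_last_def nth_append Suc del: replicate_Suc)
  qed (simp add: match_time_def)
  moreover have "pre_match_state ?h k = (\<lambda>_. K - (k - 1))" if "k \<in> {1..K}" for k
  proof -
    have "match_positions ?h ! (k - 1) = length arr + (k - 1)"
      unfolding match_positions_match_last using that by (intro nth_upt) auto
    moreover have "k - 1 \<le> K" using that by auto
    ultimately show ?thesis
      unfolding pre_match_state_def by (simp only: state_after_match_last[OF assms])
  qed
  ultimately show ?thesis
    by (simp add: total_cost_def match_positions_match_last)
qed

text \<open>Only the summand \<open>k = K\<close> has state constantly 1; charging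
  \<open>\<delta>\<close> there as well keeps the bound uniform in \<open>k\<close>.\<close>

lemma sum_single_cost_le:
  assumes "0 \<le> \<delta>"
  shows "(\<Sum>k=1..K. single_cost \<delta> (\<lambda>_::'n. K - (k - 1))) \<le> 1 + real K * \<delta>"
proof -
  have "(\<Sum>k=1..K. single_cost \<delta> (\<lambda>_::'n. K - (k - 1))) \<le> (\<Sum>k=1..K. (if k = K then 1 else 0) + \<delta>)"
    using assms by (intro sum_mono) (auto simp: single_cost_def)
  also have "\<dots> \<le> 1 + real K * \<delta>"
    by (simp add: sum.distrib sum.delta)
  finally show ?thesis .
qed

section \<open>The instance with all arrivals at time 0, and the conclusion\<close>

lemma balanced_instance_at_zero:
  obtains arr :: "'n::finite arrivals"
  where "balanced_instance arr K" and "\<And>a. a \<in> set arr \<Longrightarrow> fst a = 0"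
proof -
  obtain L :: "'n list" where L: "set L = UNIV" "distinct L"
    using finite_distinct_list[OF finite_class.finite_UNIV] by blast
  define arr :: "'n arrivals" where "arr = concat (map (\<lambda>i. replicate K (0, i)) L)"
  have zero: "fst a = 0" if "a \<in> set arr" for a
    using that by (auto simp: arr_def)
  then have "map fst arr = replicate (length arr) 0"
    by (intro replicate_eqI) auto
  then have "sorted (map fst arr)" by simp
  \<comment> \<open>Generalised from \<open>L\<close> to any distinct list for the induction;
    distinctness prevents a type from contributing two blocks.\<close>
  moreover have "length (filter (\<lambda>a. snd a = i) (concat (map (\<lambda>i. replicate K (0::real, i)) xs)))
      = (if i \<in> set xs then K else 0)" if "distinct xs" for i :: 'n and xs
    using that by (induction xs) (auto simp: filter_replicate)
  ultimately have "balanced_instance arr K"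
    using zero L by (auto simp: balanced_instance_def arr_def)
  then show ?thesis using zero that by blast
qed

theorem proposition3:
  fixes c :: "'n::finite \<Rightarrow> real"
  assumes "CARD('n) \<ge> 2"
    and "\<And>i. c i > 0"
  shows "competitive_ratio c greedy = \<infinity> \<and>
    \<not> (\<exists>\<rho>::real. \<forall>f arr K. matching_cost_function f \<longrightarrow> balanced_instance arr K \<longrightarrow>
         total_cost c f K (greedy f arr) \<le> ereal \<rho> * opt_cost c f arr K)"
proof -
  have c: "0 \<le> c i" for i using assms(2) by (simp add: less_imp_le)
  have unbounded: False
    if *: "\<And>f arr K. matching_cost_function f \<Longrightarrow> balanced_instance arr K \<Longrightarrow>
      total_cost c f K (greedy f arr) \<le> ereal \<rho> * opt_cost c f arr K" for \<rho>
  proof -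
    \<comment> \<open>The optimum will be at most 2 and Greedy pays at least \<open>K\<close>. The
      maximum with 0 also makes \<open>K\<close> positive, as the choice
      \<open>\<delta> = 1 / K\<close> requires.\<close>
    obtain K :: nat where K: "2 * max \<rho> 0 < real K" using reals_Archimedean2 by blast
    then have pos: "0 < real K" by linarith
    obtain arr :: "'n arrivals"
      where arr: "balanced_instance arr K" "\<And>a. a \<in> set arr \<Longrightarrow> fst a = 0"
      using balanced_instance_at_zero[of K] by blast
    let ?f = "single_cost (1 / real K) :: 'n state \<Rightarrow> real"
    let ?opt = "opt_cost c ?f arr K"
    have f: "matching_cost_function ?f"
      using pos by (intro matching_cost_function_single_cost) auto
    have "?opt \<le> total_cost c ?f K (match_last arr K)"
      by (intro opt_cost_le admissible_match_last arr)
    also have "\<dots> \<le> ereal 2"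
      using sum_single_cost_le[of "1 / real K" K, where 'n = 'n] pos
      by (simp add: total_cost_match_last[OF arr(1)])
    finally have opt: "?opt \<le> ereal 2" .
    have "ereal (real K) \<le> total_cost c ?f K (greedy ?f arr)"
      using c arr(1) by (rule greedy_total_cost_ge)
    also have "\<dots> \<le> ereal \<rho> * ?opt" by (rule *[OF f arr(1)])
    \<comment> \<open>\<open>\<rho>\<close> may be negative; a nonnegative factor is needed to
      insert the bound on the optimum in the next step.\<close>
    also have "\<dots> \<le> ereal (max \<rho> 0) * ?opt"
      by (intro ereal_mult_right_mono opt_cost_nonneg c f) simp
    also have "\<dots> \<le> ereal (max \<rho> 0) * ereal 2"
      by (intro ereal_mult_left_mono opt) (simp add: max_def)
    finally show False using K by (simp del: ereal_max)
  qed
  \<comment> \<open>No real \<open>\<rho>\<close> qualifies, and the infimum of the empty set of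
    extended reals is \<open>\<infinity>\<close>.\<close>
  then have "competitive_ratio c greedy = Inf {}"
    unfolding competitive_ratio_def by (intro arg_cong[where f = Inf]) blast
  then show ?thesis
    using unbounded by (metis Inf_empty top_ereal_def)
qed

end
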